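(* Let $\mu\subseteq\lambda$ be partitions with $\lambda\neq\varnothing$, let $n\ge1$ be an integer, and suppose that $s_{\lambda/\mu}(x_1,\ldots,x_n)\neq0$. For every integer $R\ge\lambda_1$ let $$E_R=C_{n,R}(\lambda/\mu)=(R^n,\mu)/\lambda,\qquad \kappa_R=(R,\ldots,R)\in\mathbb Z_{\ge0}^n.$$ Then $s_{E_R}(x_1,\ldots,x_n)\neq0$, every $\alpha\in\operatorname{supp}(s_{E_R}(x_1,\ldots,x_n))$ satisfies $\alpha\le\kappa_R$, and $$\mathcal N\bigl(s_{\lambda/\mu}(x_1,\ldots,x_n)\bigr)=\bigl(s_{E_R}(x_1,\ldots,x_n)\bigr)^{\vee,\kappa_R}.$$
   Context: Partitions are extended by zero parts whenever necessary, and $\mu\subseteq\lambda$ means $\mu_i\le\lambda_i$ for all $i$. The skew shape $\lambda/\mu$ is the set of boxes $(i,j)$ with $i\ge 1$ and $\mu_i<j\le\lambda_i$ (English notation: rows $i$ numbered from top to bottom, columns $j$ from left to right). A semistandard tableau of skew shape $D$ is a filling of the boxes of $D$ by positive integers, weakly increasing along rows and strictly increasing down columns. The skew Schur polynomial is $s_D(x_1,\ldots,x_n)=\sum_T x_1^{m_1(T)}\cdots x_n^{m_n(T)}$, where $T$ ranges over semistandard tableaux of shape $D$ with entries in $\{1,\ldots,n\}$ and $m_i(T)$ is the number of entries of $T$ equal to $i$. For integers $n,R\ge1$ and a partition $\mu$ with $\mu_1\le R$, $(R^n,\mu)$ denotes the concatenated partition $(R,\ldots,R,\mu_1,\mu_2,\ldots)$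 with $n$ initial parts equal to $R$. Whenever $\lambda\subseteq(R^n,\mu)$, the rectangular complement is $C_{n,R}(\lambda/\mu)=(R^n,\mu)/\lambda$; under the hypotheses of the claim this containment holds, so $E_R$ is a well-defined skew shape. For $\alpha\in\mathbb Z_{\ge0}^n$ put $x^\alpha=x_1^{\alpha_1}\cdots x_n^{\alpha_n}$, $\alpha!=\alpha_1!\cdots\alpha_n!$; $\alpha\le\kappa$ means coordinatewise inequality. For a polynomial $f=\sum_\alpha c_\alpha x^\alpha$, $\operatorname{supp}(f)=\{\alpha:c_\alpha\ne0\}$ and $\mathcal N(f)=\sum_\alpha\frac{c_\alpha}{\alpha!}x^\alpha$. If $\alpha\le\kappa$ for every $\alpha\in\operatorname{supp}(f)$, then $$f^{\vee,\kappa}=\mathcal N\bigl(x^\kappa f(x_1^{-1},\ldots,x_n^{-1})\bigr)=\sum_{\alpha\le\kappa}\frac{c_\alpha}{(\kappa-\alpha)!}x^{\kappa-\alpha}.$$ *)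

theory Defs
  imports Complex_Main "HOL-Library.Poly_Mapping" "HOL-Library.FuncSet"
begin

section \<open>Partitions and skew shapes\<close>

text \<open>
  A partition is the list of its positive parts; the empty partition is the empty list.
  Parts are numbered from 1, and \<open>part\<close> supplies the trailing zeros.
\<close>

definition is_partition :: "nat list \<Rightarrow> bool" where
  "is_partition l \<longleftrightarrow> sorted_wrt (\<ge>) l \<and> 0 \<notin> set l"

definition part :: "nat list \<Rightarrow> nat \<Rightarrow> nat" where
  "part l i = (if 1 \<le> i \<and> i \<le> length l then l ! (i - 1) else 0)"

definition contained :: "nat list \<Rightarrow> nat list \<Rightarrow> bool" where
  "contained mu lam \<longleftrightarrow> (\<forall>i\<ge>1. part mu i \<le> part lam i)"

definition skew_shape :: "nat list \<Rightarrow> nat list \<Rightarrow> (nat \<times> nat) set" where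
  "skew_shape lam mu = {(i, j). 1 \<le> i \<and> part mu i < j \<and> j \<le> part lam i}"

text \<open>
  Meaningful only if \<open>lam\<close> is contained in the partition \<open>replicate n R @ mu\<close>.
\<close>

definition rect_complement :: "nat \<Rightarrow> nat \<Rightarrow> nat list \<Rightarrow> nat list \<Rightarrow> (nat \<times> nat) set" where
  "rect_complement n R lam mu = skew_shape (replicate n R @ mu) lam"

section \<open>Polynomials\<close>

text \<open>
  An exponent vector in \<open>n\<close> variables is a finitely supported function on \<open>nat\<close> which vanishes
  outside \<open>{1..n}\<close>. The support of a polynomial \<open>f\<close> is \<open>Poly_Mapping.keys f\<close>.
\<close>

type_synonym expo = "nat \<Rightarrow>\<^sub>0 nat"
type_synonym rpoly = "expo \<Rightarrow>\<^sub>0 real"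

text \<open>
  The order \<open>\<le>\<close> that the library puts on \<open>expo\<close> is lexicographic, hence a separate
  coordinatewise order.
\<close>

definition expo_le :: "expo \<Rightarrow> expo \<Rightarrow> bool" where
  "expo_le \<alpha> \<kappa> \<longleftrightarrow> (\<forall>i. Poly_Mapping.lookup \<alpha> i \<le> Poly_Mapping.lookup \<kappa> i)"

definition const_expo :: "nat \<Rightarrow> nat \<Rightarrow> expo" where
  "const_expo n R = (\<Sum>i\<in>{1..n}. Poly_Mapping.single i R)"

text \<open>Coordinates outside \<open>keys \<alpha>\<close> would only contribute factors \<open>0! = 1\<close>.\<close>

definition expo_fact :: "expo \<Rightarrow> real" where
  "expo_fact \<alpha> = (\<Prod>i\<in>Poly_Mapping.keys \<alpha>. fact (Poly_Mapping.lookup \<alpha> i))"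

definition poly_N :: "rpoly \<Rightarrow> rpoly" where
  "poly_N f = (\<Sum>\<alpha>\<in>Poly_Mapping.keys f.
     Poly_Mapping.single \<alpha> (Poly_Mapping.lookup f \<alpha> / expo_fact \<alpha>))"

text \<open>
  The polynomial \<open>x^\<kappa> f(1/x_1, ..., 1/x_n)\<close>. Since subtraction of exponents truncates, this is
  meaningful only if \<open>expo_le \<alpha> \<kappa>\<close> for all \<open>\<alpha>\<close> in the support of \<open>f\<close>.
\<close>

definition poly_reflect :: "expo \<Rightarrow> rpoly \<Rightarrow> rpoly" where
  "poly_reflect \<kappa> f = (\<Sum>\<alpha>\<in>Poly_Mapping.keys f.
     Poly_Mapping.single (\<kappa> - \<alpha>) (Poly_Mapping.lookup f \<alpha>))"

definition poly_dual :: "expo \<Rightarrow> rpoly \<Rightarrow> rpoly" where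
  "poly_dual \<kappa> f = poly_N (poly_reflect \<kappa> f)"

section \<open>Skew Schur polynomials\<close>

text \<open>Using \<open>\<rightarrow>\<^sub>E\<close> makes each filling of \<open>D\<close> a single function, so that it is counted once.\<close>

definition ssyt :: "(nat \<times> nat) set \<Rightarrow> (nat \<times> nat \<Rightarrow> nat) set" where
  "ssyt D = {T \<in> D \<rightarrow>\<^sub>E {1..}.
     (\<forall>i j j'. (i, j) \<in> D \<and> (i, j') \<in> D \<and> j < j' \<longrightarrow> T (i, j) \<le> T (i, j')) \<and>
     (\<forall>i i' j. (i, j) \<in> D \<and> (i', j) \<in> D \<and> i < i' \<longrightarrow> T (i, j) < T (i', j))}"

definition content :: "nat \<Rightarrow> (nat \<times> nat) set \<Rightarrow> (nat \<times> nat \<Rightarrow> nat) \<Rightarrow> expo" where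
  "content n D T = (\<Sum>i\<in>{1..n}. Poly_Mapping.single i (card {b \<in> D. T b = i}))"

text \<open>The sum is finite whenever \<open>D\<close> is, in particular for every skew shape.\<close>

definition skew_schur :: "nat \<Rightarrow> (nat \<times> nat) set \<Rightarrow> rpoly" where
  "skew_schur n D = (\<Sum>T | T \<in> ssyt D \<and> T ` D \<subseteq> {1..n}. Poly_Mapping.single (content n D T) 1)"

lemma finite_skew_shape: "finite (skew_shape lam mu)"
proof (rule finite_subset)
  show "skew_shape lam mu \<subseteq> (\<Union>i\<in>{1..length lam}. {i} \<times> {..part lam i})"
    by (auto simp: skew_shape_def part_def split: if_splits)
qed auto

lemma finite_ssyt_bounded:
  assumes "finite D"
  shows "finite {T. T \<in> ssyt D \<and> T ` D \<subseteq> {1..n}}"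
proof (rule finite_subset)
  show "{T. T \<in> ssyt D \<and> T ` D \<subseteq> {1..n}} \<subseteq> D \<rightarrow>\<^sub>E {1..n}"
    by (fastforce simp: ssyt_def PiE_iff extensional_def)
  show "finite (D \<rightarrow>\<^sub>E {1..n})"
    using assms by (intro finite_PiE) auto
qed

end

theory Submission
  imports Defs "HOL-Combinatorics.Permutations"
begin

text \<open>
  A tableau of shape \<open>\<lambda>/\<mu>\<close> is a chain of partitions from \<open>\<mu>\<close> to \<open>\<lambda>\<close> with \<open>n\<close> horizontal strips
  as steps. Sending the chain \<open>g\<^sub>0, \<dots>, g\<^sub>n\<close> to the chain with \<open>k\<close>-th member \<open>(R\<^sup>k, g\<^sub>n\<^sub>-\<^sub>k)\<close> is a
  bijection onto the tableaux of the rectangular complement, and it turns the weight \<open>\<alpha>\<close> into the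
  reversal of \<open>\<kappa> - \<alpha>\<close>. The reversal is undone by the symmetry of skew Schur polynomials. Hence
  \<open>s\<^sub>E\<close> is the reflection \<open>x\<^sup>\<kappa> s(x\<^sub>1\<^sup>-\<^sup>1, \<dots>)\<close>, and applying the normalisation gives the claim.
\<close>

section \<open>Chains of horizontal strips\<close>

definition horizontal_strip :: "(nat \<Rightarrow> nat) \<Rightarrow> (nat \<Rightarrow> nat) \<Rightarrow> bool" where
  "horizontal_strip u v \<longleftrightarrow> (\<forall>i. v i \<le> u i \<and> u (Suc i) \<le> v i)"

text \<open>
  Rows are numbered from 0 here. The cutoff \<open>L\<close> only makes sizes finite sums: it is meant to be so
  large that \<open>l\<close> vanishes from row \<open>L\<close> on. The chain is constant after \<open>n\<close>, so that it is counted once.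
\<close>

definition strip_chains ::
  "nat \<Rightarrow> nat \<Rightarrow> (nat \<Rightarrow> nat) \<Rightarrow> (nat \<Rightarrow> nat) \<Rightarrow> (nat \<Rightarrow> nat) \<Rightarrow> (nat \<Rightarrow> nat \<Rightarrow> nat) set" where
  "strip_chains L n l m a = {g. g 0 = m \<and> (\<forall>k\<ge>n. g k = l) \<and>
     (\<forall>k<n. horizontal_strip (g (Suc k)) (g k) \<and>
            sum (g (Suc k)) {..<L} = sum (g k) {..<L} + a (Suc k))}"

lemma strip_chainsD:
  assumes "g \<in> strip_chains L n l m a"
  shows "g 0 = m" "\<And>k. n \<le> k \<Longrightarrow> g k = l"
    "\<And>k i. k < n \<Longrightarrow> g (Suc k) (Suc i) \<le> g k i"
    "\<And>k. k < n \<Longrightarrow> sum (g (Suc k)) {..<L} = sum (g k) {..<L} + a (Suc k)"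
    "\<And>k i. g k i \<le> g (Suc k) i"
proof -
  show "g k i \<le> g (Suc k) i" for k i
    using assms by (cases "k < n") (auto simp: strip_chains_def horizontal_strip_def)
qed (use assms in \<open>auto simp: strip_chains_def horizontal_strip_def\<close>)

lemma strip_chains_mono:
  assumes "g \<in> strip_chains L n l m a" "k \<le> k'"
  shows "g k i \<le> g k' i"
  using lift_Suc_mono_le[of "\<lambda>k. g k i"] strip_chainsD(5)[OF assms(1)] assms(2) by blast

lemma strip_chains_bounds:
  assumes "g \<in> strip_chains L n l m a"
  shows "m i \<le> g k i" "g k i \<le> l i"
  using strip_chains_mono[OF assms, of 0 k i] strip_chains_mono[OF assms, of k "max k n" i]
    strip_chainsD(1)[OF assms] strip_chainsD(2)[OF assms, of "max k n"] by auto

text \<open>For \<open>k < n\<close> interlacing gives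
  \<open>g k (Suc i) \<le> g (Suc k) (Suc i) \<le> g k i\<close>; from \<open>n\<close> on the
  member is \<open>l\<close> itself.\<close>

lemma strip_chains_antimono:
  assumes "g \<in> strip_chains L n l m a" "antimono l"
  shows "antimono (g k)"
proof (cases "k < n")
  case True
  have "g k (Suc i) \<le> g k i" for i
    using strip_chainsD(3)[OF assms(1) True, of i] strip_chainsD(5)[OF assms(1), of k "Suc i"]
    by linarith
  then show ?thesis by (simp add: antimono_iff_le_Suc)
qed (use strip_chainsD(2)[OF assms(1)] assms(2) in auto)

text \<open>Iterated interlacing: in \<open>j\<close> steps a column grows by at most
  \<open>j\<close> boxes. Later this bounds the columns of the shape and forces full rows in a
  complement.\<close>

lemma strip_chains_shift:
  assumes "g \<in> strip_chains L n l m a" "k + j \<le> n"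
  shows "g (k + j) (i + j) \<le> g k i"
  using assms(2)
proof (induction j)
  case (Suc j)
  then show ?case using strip_chainsD(3)[OF assms(1), of "k + j" "i + j"] by simp
qed simp

lemma horizontal_strip_size_le:
  assumes "horizontal_strip u v"
  shows "sum u {..<L} \<le> sum v {..<L} + u 0"
proof -
  \<comment> \<open>Giving \<open>u\<close> one row more than \<open>v\<close> pairs each
    \<open>u (Suc i)\<close> with \<open>v i\<close>, so that only \<open>u 0\<close> is left
    over.\<close>
  have "sum u {..<Suc L} \<le> sum v {..<L} + u 0" for L
  proof (induction L)
    case (Suc L)
    moreover have "u (Suc L) \<le> v L" using assms by (simp add: horizontal_strip_def)
    ultimately show ?case by simp
  qed simp
  from this[of L] show ?thesis by simp
qed

text \<open>A horizontal strip has at most one box per column. This is the source of all exponent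
  bounds by \<open>R\<close>.\<close>

lemma strip_chains_weight_le:
  assumes "g \<in> strip_chains L n l m a" "1 \<le> k" "k \<le> n"
  shows "a k \<le> l 0"
proof -
  obtain j where j: "k = Suc j" "j < n" using assms by (cases k) auto
  have "horizontal_strip (g k) (g j)"
    using assms(1) j by (auto simp: strip_chains_def)
  from horizontal_strip_size_le[OF this, of L] have "a k \<le> g k 0"
    using strip_chainsD(4)[OF assms(1) j(2)] j by simp
  then show ?thesis using strip_chains_bounds(2)[OF assms(1), of k 0] by simp
qed

section \<open>Symmetry in the weight\<close>

text \<open>Row 0 has no row of \<open>v\<close> above it, so there \<open>u 0\<close> is the only
  upper bound.\<close>

definition toggle_upper :: "(nat \<Rightarrow> nat) \<Rightarrow> (nat \<Rightarrow> nat) \<Rightarrow> nat \<Rightarrow> nat" where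
  "toggle_upper u v i = (case i of 0 \<Rightarrow> u 0 | Suc j \<Rightarrow> min (u i) (v j))"

text \<open>
  Between fixed neighbours \<open>v\<close> and \<open>u\<close> each part of \<open>w\<close> ranges freely over an interval;
  reflecting all these intervals is the Bender--Knuth involution.
\<close>

definition toggle :: "(nat \<Rightarrow> nat) \<Rightarrow> (nat \<Rightarrow> nat) \<Rightarrow> (nat \<Rightarrow> nat) \<Rightarrow> nat \<Rightarrow> nat" where
  "toggle u v w i = max (v i) (u (Suc i)) + toggle_upper u v i - w i"

text \<open>The conditions on \<open>w\<close> separate into one interval per row, so the rows can
  be reflected independently.\<close>

lemma between_strips_iff:
  "horizontal_strip u w \<and> horizontal_strip w v \<longleftrightarrow>
    (\<forall>i. max (v i) (u (Suc i)) \<le> w i \<and> w i \<le> toggle_upper u v i)"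
proof -
  have "(\<forall>i. w i \<le> toggle_upper u v i) \<longleftrightarrow> (\<forall>i. w i \<le> u i) \<and> (\<forall>i. w (Suc i) \<le> v i)"
    unfolding toggle_upper_def by (auto split: nat.splits) (metis not0_implies_Suc)+
  then show ?thesis unfolding horizontal_strip_def by auto
qed

lemma toggle_strips:
  assumes "horizontal_strip u w" "horizontal_strip w v"
  shows "horizontal_strip u (toggle u v w)" "horizontal_strip (toggle u v w) v"
    "toggle u v (toggle u v w) = w"
proof -
  have *: "max (v i) (u (Suc i)) \<le> w i \<and> w i \<le> toggle_upper u v i" for i
    using assms between_strips_iff by blast
  have "horizontal_strip u (toggle u v w) \<and> horizontal_strip (toggle u v w) v"
    unfolding between_strips_iff
  proof
    fix i
    show "max (v i) (u (Suc i)) \<le> toggle u v w i \<and> toggle u v w i \<le> toggle_upper u v i"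
      using *[of i] unfolding toggle_def by linarith
  qed
  then show "horizontal_strip u (toggle u v w)" "horizontal_strip (toggle u v w) v" by auto
  show "toggle u v (toggle u v w) = w"
  proof
    fix i show "toggle u v (toggle u v w) i = w i" using *[of i] unfolding toggle_def by linarith
  qed
qed

text \<open>The lower end in row \<open>N\<close> and the upper end in row \<open>Suc N\<close> are
  the maximum and the minimum of the same two numbers, \<open>v N\<close> and
  \<open>u (Suc N)\<close>, so the sum of all interval ends telescopes.\<close>

lemma toggle_size:
  assumes "horizontal_strip u w" "horizontal_strip w v" "u L = 0"
  shows "sum (toggle u v w) {..<L} + sum w {..<L} = sum u {..<L} + sum v {..<L}"
proof -
  have *: "max (v i) (u (Suc i)) \<le> w i \<and> w i \<le> toggle_upper u v i" for i
    using assms between_strips_iff by blast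
  \<comment> \<open>The single terms are the boundary terms of the telescoping; at
    \<open>N = L\<close> both vanish because \<open>u L = 0\<close>.\<close>
  have "(\<Sum>i<N. toggle u v w i + w i) + toggle_upper u v N = (\<Sum>i<N. u i + v i) + u N" for N
  proof (induction N)
    case (Suc N)
    have "toggle u v w N + w N = max (v N) (u (Suc N)) + toggle_upper u v N"
      using *[of N] unfolding toggle_def by linarith
    moreover have "max (v N) (u (Suc N)) + toggle_upper u v (Suc N) = v N + u (Suc N)"
      unfolding toggle_upper_def by simp
    ultimately show ?case using Suc by simp
  qed (simp add: toggle_upper_def)
  from this[of L] assms(3) show ?thesis
    by (cases L) (auto simp: sum.distrib toggle_upper_def)
qed

definition toggle_chain :: "nat \<Rightarrow> (nat \<Rightarrow> nat \<Rightarrow> nat) \<Rightarrow> nat \<Rightarrow> nat \<Rightarrow> nat" where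
  "toggle_chain k g = g(Suc k := toggle (g (Suc (Suc k))) (g k) (g (Suc k)))"

text \<open>By \<open>toggle_size\<close> the two steps around the new member exchange their sizes;
  all other steps are unchanged.\<close>

lemma toggle_chain:
  assumes g: "g \<in> strip_chains L n l m a" and k: "Suc (Suc k) \<le> n" and L: "l L = 0"
  shows "toggle_chain k g \<in> strip_chains L n l m (a \<circ> transpose (Suc k) (Suc (Suc k)))"
    "toggle_chain k (toggle_chain k g) = g"
proof -
  let ?u = "g (Suc (Suc k))" and ?w = "g (Suc k)" and ?v = "g k"
  let ?t = "toggle ?u ?v ?w"
  have hs: "horizontal_strip (g (Suc j)) (g j)" if "j < n" for j
    using g that by (auto simp: strip_chains_def)
  have uw: "horizontal_strip ?u ?w" and wv: "horizontal_strip ?w ?v"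
    using hs[of k] hs[of "Suc k"] k by auto
  have uL: "?u L = 0" using strip_chains_bounds(2)[OF g, of "Suc (Suc k)" L] L by simp
  note t = toggle_strips[OF uw wv] toggle_size[OF uw wv uL]
  note s = strip_chainsD(4)[OF g]
  have s1: "sum ?w {..<L} = sum ?v {..<L} + a (Suc k)"
    and s2: "sum ?u {..<L} = sum ?w {..<L} + a (Suc (Suc k))"
    using s[of k] s[of "Suc k"] k by auto
  have st: "sum ?t {..<L} = sum ?v {..<L} + a (Suc (Suc k))"
    "sum ?u {..<L} = sum ?t {..<L} + a (Suc k)"
    using s1 s2 t(4) by linarith+
  show "toggle_chain k (toggle_chain k g) = g"
    using t(3) by (auto simp: toggle_chain_def fun_eq_iff)
  let ?h = "toggle_chain k g" and ?b = "a \<circ> transpose (Suc k) (Suc (Suc k))"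
  have "horizontal_strip (?h (Suc j)) (?h j) \<and>
        sum (?h (Suc j)) {..<L} = sum (?h j) {..<L} + ?b (Suc j)" if j: "j < n" for j
  proof -
    consider "j = k" | "j = Suc k" | "j \<noteq> k" "j \<noteq> Suc k" by blast
    then show ?thesis
    proof cases
      case 1
      then show ?thesis using t st by (simp add: toggle_chain_def)
    next
      case 2
      then show ?thesis using t st by (simp add: toggle_chain_def)
    next
      case 3
      then show ?thesis using hs[OF j] s[OF j]
        by (simp add: toggle_chain_def transpose_def)
    qed
  qed
  then show "?h \<in> strip_chains L n l m ?b"
    using g k by (auto simp: strip_chains_def toggle_chain_def)
qed

section \<open>From adjacent swaps to arbitrary permutations of the weight\<close>

lemma card_strip_chains_adjacent:
  assumes "Suc (Suc k) \<le> n" "l L = 0"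
  shows "card (strip_chains L n l m (a \<circ> transpose (Suc k) (Suc (Suc k)))) =
         card (strip_chains L n l m a)"
proof -
  let ?t = "transpose (Suc k) (Suc (Suc k))"
  \<comment> \<open>Swapping the weight twice restores \<open>a\<close>, so the same map also leads
    back.\<close>
  have inv: "toggle_chain k g \<in> strip_chains L n l m a"
    if "g \<in> strip_chains L n l m (a \<circ> ?t)" for g
    using toggle_chain(1)[of g L n l m "a \<circ> ?t" k] that assms by (simp add: comp_assoc)
  have "bij_betw (toggle_chain k) (strip_chains L n l m a) (strip_chains L n l m (a \<circ> ?t))"
    by (rule bij_betw_byWitness[where f' = "toggle_chain k"])
      (use toggle_chain(1)[of _ L n l m a k] toggle_chain(2)[of _ L n l m _ k] assms inv in blast)+
  then show ?thesis by (simp add: bij_betw_same_card)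
qed

lemma card_strip_chains_transpose:
  assumes "1 \<le> i" "i \<le> j" "j \<le> n" "l L = 0"
  shows "card (strip_chains L n l m (a \<circ> transpose i j)) = card (strip_chains L n l m a)"
  using assms(2,3)
proof (induction j arbitrary: a rule: dec_induct)
  case base
  then show ?case by (simp add: transpose_same)
next
  case (step j)
  obtain k where k: "j = Suc k" using assms(1) step by (cases j) auto
  let ?s = "transpose j (Suc j)"
  have adj: "card (strip_chains L n l m (c \<circ> ?s)) = card (strip_chains L n l m c)" for c
    using card_strip_chains_adjacent[of k n l L m c] assms(4) step k by simp
  show ?case
  proof (cases "i = j")
    case True
    then show ?thesis using adj[of a] by (simp only:)
  next
    case False
    \<comment> \<open>Conjugation by an adjacent swap: \<open>adj\<close> removes the two outer
      factors, the induction hypothesis for \<open>a \<circ> ?s\<close> the inner one.\<close>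
    have "transpose i (Suc j) = ?s \<circ> transpose i j \<circ> ?s"
      using False step(1) by (auto simp: fun_eq_iff transpose_def)
    then show ?thesis
      using adj[of "a \<circ> ?s \<circ> transpose i j"] adj[of a] step(3)[of "a \<circ> ?s"]
        step(1,2,4) by (simp only: comp_assoc)
  qed
qed

lemma card_strip_chains_permute:
  assumes "p permutes {1..n}" "l L = 0"
  shows "card (strip_chains L n l m (a \<circ> p)) = card (strip_chains L n l m a)"
  using assms(1) finite_atLeastAtMost
proof (induction p arbitrary: a rule: permutes_induct)
  case id
  then show ?case by simp
next
  case (swap i j p)
  have "card (strip_chains L n l m (a \<circ> transpose i j)) = card (strip_chains L n l m a)"
  proof (cases "i \<le> j")
    case True
    then show ?thesis using card_strip_chains_transpose[of i j n l L m a] swap assms by simp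
  next
    case False
    then show ?thesis using card_strip_chains_transpose[of j i n l L m a] swap assms
      by (simp add: transpose_commute)
  qed
  then show ?case using swap by (metis comp_assoc)
qed

section \<open>Rectangular complements of chains\<close>

definition complement_rows :: "nat \<Rightarrow> nat \<Rightarrow> (nat \<Rightarrow> nat) \<Rightarrow> nat \<Rightarrow> nat" where
  "complement_rows k R f i = (if i < k then R else f (i - k))"

text \<open>Both \<open>min k n\<close> and the truncation in \<open>n - k\<close> serve to keep the
  chain constant from \<open>n\<close> on.\<close>

definition complement_chain :: "nat \<Rightarrow> nat \<Rightarrow> (nat \<Rightarrow> nat \<Rightarrow> nat) \<Rightarrow> nat \<Rightarrow> nat \<Rightarrow> nat" where
  "complement_chain n R g k = complement_rows (min k n) R (g (n - k))"

text \<open>Deletes the \<open>n - k\<close> full rows on top of member \<open>n - k\<close>. For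
  \<open>k \<ge> n\<close> truncation yields \<open>h 0\<close>, the required constant tail.\<close>

definition uncomplement_chain :: "nat \<Rightarrow> (nat \<Rightarrow> nat \<Rightarrow> nat) \<Rightarrow> nat \<Rightarrow> nat \<Rightarrow> nat" where
  "uncomplement_chain n h k i = h (n - k) (i + (n - k))"

text \<open>The rows of \<open>f\<close> are pushed down by \<open>k\<close>; the first assumption
  ensures that nothing but zeros passes the cutoff.\<close>

lemma sum_complement_rows:
  assumes "\<And>i. L \<le> i + k \<Longrightarrow> f i = 0" "k \<le> L"
  shows "sum (complement_rows k R f) {..<L} = k * R + sum f {..<L}"
proof -
  have "sum (complement_rows k R f) {..<k + d} = k * R + sum f {..<d}" for d
    by (induction d) (auto simp: complement_rows_def)
  from this[of "L - k"] assms(2)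
  have "sum (complement_rows k R f) {..<L} = k * R + sum f {..<L - k}" by simp
  also have "sum f {..<L - k} = sum f {..<L}"
    by (rule sum.mono_neutral_left) (use assms in auto)
  finally show ?thesis .
qed

text \<open>Reading the chain backwards with one more full row each time exchanges inclusion and
  interlacing in the strip condition, and turns a step of size \<open>a\<close> into one of size
  \<open>R - a\<close>.\<close>

lemma complement_chain_in_strip_chains:
  assumes g: "g \<in> strip_chains L n l m a"
    and R: "l 0 \<le> R" and L: "\<And>i. L \<le> i + n \<Longrightarrow> l i = 0" "n \<le> L"
    and ab: "\<And>k. k < n \<Longrightarrow> a (n - k) + b (Suc k) = R"
  shows "complement_chain n R g \<in> strip_chains L n (complement_rows n R m) l b"
proof -
  let ?h = "complement_chain n R g"
  have size: "sum (?h k) {..<L} = k * R + sum (g (n - k)) {..<L}" if "k \<le> n" for k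
  proof -
    have "g (n - k) i = 0" if "L \<le> i + k" for i
      using L(1)[of i] strip_chains_bounds(2)[OF g, of "n - k" i] that \<open>k \<le> n\<close> by simp
    then show ?thesis
      using sum_complement_rows[of L k "g (n - k)" R] that L(2)
      by (simp add: complement_chain_def min_absorb1)
  qed
  have g0: "g k 0 \<le> R" for k using strip_chains_bounds(2)[OF g, of k 0] R by simp
  have "horizontal_strip (?h (Suc k)) (?h k) \<and>
        sum (?h (Suc k)) {..<L} = sum (?h k) {..<L} + b (Suc k)" if k: "k < n" for k
  proof
    define j where "j = n - Suc k"
    have j: "n - k = Suc j" "n - Suc k = j" "j < n" using k by (auto simp: j_def)
    show "horizontal_strip (?h (Suc k)) (?h k)"
      unfolding horizontal_strip_def
    proof
      fix i
      \<comment> \<open>Rows full in both members, the row that becomes full, and the shifted rows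
        below.\<close>
      consider "i < k" | "i = k" | d where "i = Suc (k + d)"
        by (metis less_imp_Suc_add linorder_neqE_nat)
      then show "?h k i \<le> ?h (Suc k) i \<and> ?h (Suc k) (Suc i) \<le> ?h k i"
        by cases
          (use k j g0 strip_chainsD(5)[OF g] strip_chainsD(3)[OF g \<open>j < n\<close>] in
            \<open>simp_all add: complement_chain_def complement_rows_def min_absorb1\<close>)
    qed
    show "sum (?h (Suc k)) {..<L} = sum (?h k) {..<L} + b (Suc k)"
      using size[of k] size[of "Suc k"] k j strip_chainsD(4)[OF g j(3)] ab[OF k] by simp
  qed
  moreover have "?h 0 = l" "\<forall>k\<ge>n. ?h k = complement_rows n R m"
    using strip_chainsD(1,2)[OF g]
    by (auto simp: complement_chain_def complement_rows_def fun_eq_iff)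
  ultimately show ?thesis by (simp add: strip_chains_def)
qed

text \<open>
  In a chain ending in the complement, each step moves the block of full rows by at most one,
  so its \<open>k\<close>-th member must already start with \<open>k\<close> full rows.
\<close>

lemma complement_uncomplement:
  assumes h: "h \<in> strip_chains L n (complement_rows n R m) l b"
    and R: "\<And>i. m i \<le> R"
  shows "complement_chain n R (uncomplement_chain n h) = h"
proof -
  let ?e = "complement_rows n R m"
  have top: "h k i = R" if "i < k" "k \<le> n" for k i
  proof (rule antisym)
    show "h k i \<le> R"
      using strip_chains_bounds(2)[OF h, of k i] R that by (simp add: complement_rows_def)
    have "h n (i + (n - k)) \<le> h k i"
      using strip_chains_shift[OF h, of k "n - k" i] that by simp
    then show "R \<le> h k i"
      using that strip_chainsD(2)[OF h, of n] by (simp add: complement_rows_def split: if_splits)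
  qed
  show ?thesis
  proof (intro ext)
    fix k i
    show "complement_chain n R (uncomplement_chain n h) k i = h k i"
      using top[of i "min k n"] strip_chainsD(2)[OF h, of k] strip_chainsD(2)[OF h, of n]
      by (cases "k \<le> n") (auto simp: complement_chain_def complement_rows_def
          uncomplement_chain_def min_def)
  qed
qed

lemma uncomplement_chain_in_strip_chains:
  assumes h: "h \<in> strip_chains L n (complement_rows n R m) l b"
    and R: "\<And>i. m i \<le> R" and L: "\<And>i. L \<le> i + n \<Longrightarrow> m i = 0" "n \<le> L"
    and ab: "\<And>k. k < n \<Longrightarrow> a (n - k) + b (Suc k) = R"
  shows "uncomplement_chain n h \<in> strip_chains L n l m a"
proof -
  let ?g = "uncomplement_chain n h"
  \<comment> \<open>Member \<open>r\<close> consists of \<open>r\<close> full rows above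
    \<open>?g (n - r)\<close>, so the sizes of \<open>?g\<close> can be read off from those of
    \<open>h\<close>.\<close>
  have hg: "h r = complement_rows r R (?g (n - r))" if "r \<le> n" for r
    using fun_cong[OF complement_uncomplement[OF h R], of r] that
    by (simp add: complement_chain_def min_absorb1)
  have size: "sum (h r) {..<L} = r * R + sum (?g (n - r)) {..<L}" if "r \<le> n" for r
  proof -
    have "?g (n - r) i = 0" if "L \<le> i + r" for i
      using strip_chains_bounds(2)[OF h, of r "i + r"] that \<open>r \<le> n\<close> L
      by (auto simp: uncomplement_chain_def complement_rows_def split: if_splits)
    then show ?thesis
      using sum_complement_rows[of L r "?g (n - r)" R] hg[OF that] that L(2) by simp
  qed
  have "horizontal_strip (?g (Suc k)) (?g k) \<and>
        sum (?g (Suc k)) {..<L} = sum (?g k) {..<L} + a (Suc k)" if k: "k < n" for k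
  proof
    define r where "r = n - Suc k"
    have r: "n - k = Suc r" "n - Suc k = r" "r < n" "n - Suc r = k" "n - r = Suc k"
      using k by (auto simp: r_def)
    show "horizontal_strip (?g (Suc k)) (?g k)"
      using strip_chainsD(5)[OF h, of r] strip_chainsD(3)[OF h r(3)]
      by (simp add: horizontal_strip_def uncomplement_chain_def r)
    show "sum (?g (Suc k)) {..<L} = sum (?g k) {..<L} + a (Suc k)"
      using size[of r] size[of "Suc r"] r strip_chainsD(4)[OF h r(3)] ab[OF r(3)] by simp
  qed
  moreover have "?g 0 = m" "\<forall>k\<ge>n. ?g k = l"
    using strip_chainsD(1,2)[OF h]
    by (auto simp: uncomplement_chain_def complement_rows_def fun_eq_iff)
  ultimately show ?thesis by (simp add: strip_chains_def)
qed

text \<open>Step \<open>Suc k\<close> of the complement comes from step \<open>n - k\<close> of the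
  original chain, hence the index reversal in the weights.\<close>

lemma card_strip_chains_complement:
  assumes "l 0 \<le> R" "\<And>i. m i \<le> R"
    and "\<And>i. L \<le> i + n \<Longrightarrow> l i = 0" "\<And>i. L \<le> i + n \<Longrightarrow> m i = 0" "n \<le> L"
    and "\<And>k. k < n \<Longrightarrow> a (n - k) + b (Suc k) = R"
  shows "card (strip_chains L n l m a) = card (strip_chains L n (complement_rows n R m) l b)"
proof (rule bij_betw_same_card)
  show "bij_betw (complement_chain n R) (strip_chains L n l m a)
    (strip_chains L n (complement_rows n R m) l b)"
  proof (rule bij_betw_byWitness[where f' = "uncomplement_chain n"])
    show "\<forall>g\<in>strip_chains L n l m a. uncomplement_chain n (complement_chain n R g) = g"
    proof
      fix g assume g: "g \<in> strip_chains L n l m a"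
      show "uncomplement_chain n (complement_chain n R g) = g"
      proof (intro ext)
        fix k i
        show "uncomplement_chain n (complement_chain n R g) k i = g k i"
          using strip_chainsD(2)[OF g, of k] strip_chainsD(2)[OF g, of n]
          by (cases "k \<le> n")
            (auto simp: uncomplement_chain_def complement_chain_def complement_rows_def)
      qed
    qed
    show "\<forall>h\<in>strip_chains L n (complement_rows n R m) l b.
        complement_chain n R (uncomplement_chain n h) = h"
      by (intro ballI complement_uncomplement[of _ L n R m l b] assms)
    show "complement_chain n R ` strip_chains L n l m a \<subseteq>
        strip_chains L n (complement_rows n R m) l b"
      by (intro image_subsetI complement_chain_in_strip_chains[of _ L n l m a R b] assms)
    show "uncomplement_chain n ` strip_chains L n (complement_rows n R m) l b \<subseteq>
        strip_chains L n l m a"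
      by (intro image_subsetI uncomplement_chain_in_strip_chains[of _ L n R m l b a] assms)
  qed
qed

section \<open>Tableaux as chains\<close>

text \<open>Converts the numbering of rows from 0, used for chains, to that from 1, used for
  boxes.\<close>

definition row_shape :: "(nat \<Rightarrow> nat) \<Rightarrow> (nat \<Rightarrow> nat) \<Rightarrow> (nat \<times> nat) set" where
  "row_shape l m = {(Suc i, j) | i j. m i < j \<and> j \<le> l i}"

definition weighted_ssyt :: "nat \<Rightarrow> (nat \<times> nat) set \<Rightarrow> (nat \<Rightarrow> nat) \<Rightarrow> (nat \<times> nat \<Rightarrow> nat) set" where
  "weighted_ssyt n D a =
     {T \<in> ssyt D. T ` D \<subseteq> {1..n} \<and> (\<forall>k\<in>{1..n}. card {b \<in> D. T b = k} = a k)}"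

text \<open>Row lengths of the partition formed by the inner shape and the boxes with entry at most
  \<open>k\<close>.\<close>

definition chain_of_tableau ::
  "(nat \<Rightarrow> nat) \<Rightarrow> (nat \<Rightarrow> nat) \<Rightarrow> (nat \<times> nat \<Rightarrow> nat) \<Rightarrow> nat \<Rightarrow> nat \<Rightarrow> nat" where
  "chain_of_tableau l m T k i = card {j \<in> {1..l i}. j \<le> m i \<or> T (Suc i, j) \<le> k}"

text \<open>The entry of a box is the time at which the chain first contains it.\<close>

definition tableau_of_chain ::
  "(nat \<Rightarrow> nat) \<Rightarrow> (nat \<Rightarrow> nat) \<Rightarrow> (nat \<Rightarrow> nat \<Rightarrow> nat) \<Rightarrow> nat \<times> nat \<Rightarrow> nat" where
  "tableau_of_chain l m g = (\<lambda>b\<in>row_shape l m. LEAST k. snd b \<le> g k (fst b - 1))"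

lemma mem_row_shape [simp]: "(Suc i, j) \<in> row_shape l m \<longleftrightarrow> m i < j \<and> j \<le> l i"
  by (simp add: row_shape_def)

lemma mem_initial_segment_iff:
  fixes A :: "nat set"
  assumes "A \<subseteq> {1..N}" "\<And>i j. j \<in> A \<Longrightarrow> 1 \<le> i \<Longrightarrow> i \<le> j \<Longrightarrow> i \<in> A"
  shows "j \<in> A \<longleftrightarrow> 1 \<le> j \<and> j \<le> card A"
proof -
  have fin: "finite A" using assms(1) finite_subset by blast
  have "\<exists>k. A = {1..k}"
  proof (cases "A = {}")
    case False
    have "{1..Max A} \<subseteq> A" using assms(2)[OF Max_in[OF fin False]] by auto
    moreover have "A \<subseteq> {1..Max A}" using assms(1) Max_ge[OF fin] by fastforce
    ultimately show ?thesis by blast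
  qed (auto intro: exI[of _ 0])
  then obtain k where "A = {1..k}" ..
  then show ?thesis by simp
qed

text \<open>As rows increase weakly, the counted columns form an initial segment, so comparison with
  its size tests membership. Columns start at 1, which sets \<open>j = 0\<close> apart.\<close>

lemma le_chain_of_tableau_iff:
  assumes "T \<in> ssyt (row_shape l m)"
  shows "j \<le> chain_of_tableau l m T k i \<longleftrightarrow> j = 0 \<or> j \<le> l i \<and> (j \<le> m i \<or> T (Suc i, j) \<le> k)"
proof -
  let ?A = "{j \<in> {1..l i}. j \<le> m i \<or> T (Suc i, j) \<le> k}"
  have *: "j \<in> ?A \<longleftrightarrow> 1 \<le> j \<and> j \<le> card ?A"
  proof (rule mem_initial_segment_iff)
    fix j' j assume j: "j \<in> ?A" "1 \<le> j'" "j' \<le> j"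
    have "T (Suc i, j') \<le> T (Suc i, j)" if "m i < j'" "j' < j"
    proof -
      have "(Suc i, j') \<in> row_shape l m" "(Suc i, j) \<in> row_shape l m" using that j by auto
      then show ?thesis using assms that unfolding ssyt_def by blast
    qed
    then show "j' \<in> ?A" using j by (cases "j' = j") force+
  qed auto
  show ?thesis
  proof (cases "j = 0")
    case False
    then show ?thesis using * unfolding chain_of_tableau_def by simp
  qed simp
qed

text \<open>The box lies in the member \<open>g n\<close>, so a least index exists; since the chain
  increases, the box lies in all members from there on.\<close>

lemma tableau_of_chain_le_iff:
  assumes g: "g \<in> strip_chains L n l m a" and b: "m i < j" "j \<le> l i"
  shows "tableau_of_chain l m g (Suc i, j) \<le> k \<longleftrightarrow> j \<le> g k i"
proof -
  have eq: "tableau_of_chain l m g (Suc i, j) = (LEAST k. j \<le> g k i)"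
    using b by (simp add: tableau_of_chain_def)
  have "j \<le> g n i" using strip_chainsD(2)[OF g, of n] b by simp
  then have "j \<le> g (LEAST k. j \<le> g k i) i" by (rule LeastI)
  then show ?thesis
    unfolding eq using strip_chains_mono[OF g, of "LEAST k. j \<le> g k i" k i]
    by (auto intro: Least_le)
qed

lemma row_entries_eq:
  assumes "\<And>k j. m i < j \<Longrightarrow> j \<le> l i \<Longrightarrow> T (Suc i, j) \<le> k \<longleftrightarrow> j \<le> g k i"
    and "m i \<le> g k i" "g (Suc k) i \<le> l i"
  shows "{j. (Suc i, j) \<in> row_shape l m \<and> T (Suc i, j) = Suc k} = {g k i<..g (Suc k) i}"
proof -
  have "T (Suc i, j) = Suc k \<longleftrightarrow> g k i < j \<and> j \<le> g (Suc k) i" if "m i < j" "j \<le> l i" for j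
    using assms(1)[OF that, of k] assms(1)[OF that, of "Suc k"] by linarith
  then show ?thesis using assms(2,3) by auto
qed

text \<open>In each row \<open>Suc k\<close> fills exactly the columns that \<open>g (Suc k)\<close>
  adds to \<open>g k\<close>. Any linked \<open>T\<close> and \<open>g\<close> are allowed, so both
  directions of the bijection can use this.\<close>

lemma card_entries_eq:
  assumes T: "\<And>i k j. m i < j \<Longrightarrow> j \<le> l i \<Longrightarrow> T (Suc i, j) \<le> k \<longleftrightarrow> j \<le> g k i"
    and g: "\<And>k i. m i \<le> g k i" "\<And>k i. g k i \<le> l i" "\<And>i. g k i \<le> g (Suc k) i"
    and L: "\<And>i. L \<le> i \<Longrightarrow> l i = 0"
  shows "sum (g (Suc k)) {..<L} = sum (g k) {..<L} +
    card {b \<in> row_shape l m. T b = Suc k}"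
proof -
  let ?B = "{b \<in> row_shape l m. T b = Suc k}"
  have "?B = (\<Union>i\<in>{..<L}. Pair (Suc i) ` {g k i<..g (Suc k) i})"
  proof (intro set_eqI iffI)
    fix b assume b: "b \<in> ?B"
    then obtain i j where ij: "b = (Suc i, j)" "m i < j" "j \<le> l i" by (auto simp: row_shape_def)
    then have "i < L" using L[of i] by (cases "i < L") auto
    moreover have "j \<in> {g k i<..g (Suc k) i}"
      using b ij row_entries_eq[of m i l T g k] T g by blast
    ultimately show "b \<in> (\<Union>i\<in>{..<L}. Pair (Suc i) ` {g k i<..g (Suc k) i})" using ij by blast
  next
    fix b assume "b \<in> (\<Union>i\<in>{..<L}. Pair (Suc i) ` {g k i<..g (Suc k) i})"
    then show "b \<in> ?B" using row_entries_eq[of m _ l T g k] T g by blast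
  qed
  also have "card \<dots> = (\<Sum>i<L. card (Pair (Suc i) ` {g k i<..g (Suc k) i}))"
    by (rule card_UN_disjoint) auto
  also have "\<dots> = (\<Sum>i<L. g (Suc k) i - g k i)" by (simp add: card_image inj_on_def)
  finally have "card ?B = (\<Sum>i<L. g (Suc k) i - g k i)" .
  moreover have "sum (g (Suc k)) {..<L} = (\<Sum>i<L. g k i + (g (Suc k) i - g k i))"
    using g(3) by simp
  ultimately show ?thesis by (simp add: sum.distrib)
qed

lemma chain_of_tableau_in_strip_chains:
  assumes T: "T \<in> weighted_ssyt n (row_shape l m) a"
    and lm: "antimono l" "antimono m" "\<And>i. m i \<le> l i"
    and L: "\<And>i. L \<le> i \<Longrightarrow> l i = 0"
  shows "chain_of_tableau l m T \<in> strip_chains L n l m a"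
proof -
  let ?D = "row_shape l m" and ?g = "chain_of_tableau l m T"
  have ss: "T \<in> ssyt ?D" and bd: "T ` ?D \<subseteq> {1..n}"
    and wt: "\<And>k. k < n \<Longrightarrow> card {b \<in> ?D. T b = Suc k} = a (Suc k)"
    using T by (auto simp: weighted_ssyt_def)
  note iff = le_chain_of_tableau_iff[OF ss]
  have box: "1 \<le> T (Suc i, j) \<and> T (Suc i, j) \<le> n" if "m i < j" "j \<le> l i" for i j
    using bd that by (metis atLeastAtMost_iff image_subset_iff mem_row_shape)
  have lo: "m i \<le> ?g k i" for k i using iff lm(3) by blast
  have hi: "?g k i \<le> l i" for k i using iff[of "?g k i" k i] by auto
  have up: "?g k i \<le> ?g (Suc k) i" for k i
    using iff[of "?g k i" k i] iff[of "?g k i" "Suc k" i] by auto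
  have zero: "?g 0 = m"
  proof
    fix i
    have "?g 0 i \<le> m i" using iff[of "?g 0 i" 0 i] box[of i "?g 0 i"] by fastforce
    then show "?g 0 i = m i" using lo[of i 0] by simp
  qed
  have final: "?g k = l" if "n \<le> k" for k
  proof
    fix i
    have "l i \<le> ?g k i" using iff[of "l i" k i] box[of i "l i"] that by fastforce
    then show "?g k i = l i" using hi[of k i] by simp
  qed
  have strip: "?g (Suc k) (Suc i) \<le> ?g k i" for k i
  proof (rule ccontr)
    assume *: "\<not> ?thesis"
    \<comment> \<open>Column \<open>j\<close> ends row \<open>Suc i\<close> of member
      \<open>Suc k\<close>, so its entry there is at most \<open>Suc k\<close>. The box above it
      lies in the shape and has an entry at most \<open>k\<close>, hence belongs to member
      \<open>k\<close>: a contradiction.\<close>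
    define j where "j = ?g (Suc k) (Suc i)"
    have j: "?g k i < j" using * j_def by simp
    have mi: "m (Suc i) \<le> m i" "l (Suc i) \<le> l i" using lm by (auto simp: antimono_def)
    have mj: "m i < j" using lo[of i k] j by simp
    have lj: "j \<le> l (Suc i)" using hi[of "Suc k" "Suc i"] j_def by simp
    have "T (Suc (Suc i), j) \<le> Suc k"
      using iff[of j "Suc k" "Suc i"] j_def mj mi by auto
    moreover have "T (Suc i, j) < T (Suc (Suc i), j)"
    proof -
      have "(Suc i, j) \<in> ?D" "(Suc (Suc i), j) \<in> ?D" using mj lj mi by auto
      then show ?thesis using ss unfolding ssyt_def by blast
    qed
    ultimately have "j \<le> ?g k i" using iff[of j k i] lj mi by auto
    then show False using j by simp
  qed
  have eq: "T (Suc i, j) \<le> k \<longleftrightarrow> j \<le> ?g k i" if "m i < j" "j \<le> l i" for i j k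
    using iff[of j k i] that by auto
  have "sum (?g (Suc k)) {..<L} = sum (?g k) {..<L} + card {b \<in> ?D. T b = Suc k}" for k
    by (rule card_entries_eq) (fact eq lo hi up L)+
  then show ?thesis
    using zero final strip up wt unfolding strip_chains_def horizontal_strip_def by simp
qed

lemma tableau_of_chain_in_weighted_ssyt:
  assumes g: "g \<in> strip_chains L n l m a"
    and l: "antimono l" and L: "\<And>i. L \<le> i \<Longrightarrow> l i = 0"
  shows "tableau_of_chain l m g \<in> weighted_ssyt n (row_shape l m) a"
proof -
  let ?D = "row_shape l m" and ?T = "tableau_of_chain l m g"
  note iff = tableau_of_chain_le_iff[OF g]
  have range: "?T b \<in> {1..n}" if bD: "b \<in> ?D" for b
  proof -
    obtain i j where b: "b = (Suc i, j)" "m i < j" "j \<le> l i"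
      using bD by (auto simp: row_shape_def)
    have "\<not> ?T b \<le> 0" "?T b \<le> n"
      using iff[OF b(2,3), of 0] iff[OF b(2,3), of n] b strip_chainsD(1)[OF g]
        strip_chainsD(2)[OF g, of n] by auto
    then show ?thesis by simp
  qed
  have rows: "?T (i, j) \<le> ?T (i, j')" if b: "(i, j) \<in> ?D" "(i, j') \<in> ?D" "j < j'" for i j j'
  proof -
    obtain r where r: "i = Suc r" using b by (auto simp: row_shape_def)
    have "j' \<le> g (?T (i, j')) r" using iff[of r j' "?T (i, j')"] b r by auto
    then show ?thesis using iff[of r j "?T (i, j')"] b r by auto
  qed
  have cols: "?T (i, j) < ?T (i', j)" if b: "(i, j) \<in> ?D" "(i', j) \<in> ?D" "i < i'" for i i' j
  proof -
    obtain r r' where r: "i = Suc r" "i' = Suc r'" "r < r'" using b by (auto simp: row_shape_def)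
    obtain k where k: "?T (i', j) = Suc k" "k < n" using range[OF b(2)] by (cases "?T (i', j)") auto
    \<comment> \<open>Within member \<open>Suc k\<close> monotonicity leads from row
      \<open>r'\<close> up to row \<open>Suc r\<close>; interlacing then leads to row
      \<open>r\<close> of member \<open>k\<close>.\<close>
    have "j \<le> g (Suc k) r'" using iff[of r' j "Suc k"] k r b by auto
    also have "\<dots> \<le> g (Suc k) (Suc r)"
      using strip_chains_antimono[OF g l, of "Suc k"] r by (auto simp: antimono_def)
    also have "\<dots> \<le> g k r" using strip_chainsD(3)[OF g k(2)] .
    finally have "?T (i, j) \<le> k" using iff[of r j k] r b by auto
    then show ?thesis using k by simp
  qed
  have "sum (g (Suc k)) {..<L} = sum (g k) {..<L} + card {b \<in> ?D. ?T b = Suc k}" for k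
    by (rule card_entries_eq) (fact iff strip_chains_bounds[OF g] strip_chainsD(5)[OF g] L)+
  then have "card {b \<in> ?D. ?T b = Suc k} = a (Suc k)" if "k < n" for k
    using strip_chainsD(4)[OF g that] by simp
  then have "card {b \<in> ?D. ?T b = k} = a k" if "k \<in> {1..n}" for k
    using that by (cases k) auto
  moreover have "?T \<in> ?D \<rightarrow>\<^sub>E {1..}"
    using range by (auto simp: PiE_iff tableau_of_chain_def)
  moreover have "?T ` ?D \<subseteq> {1..n}" using range by (rule image_subsetI)
  moreover have "\<forall>i j j'. (i, j) \<in> ?D \<and> (i, j') \<in> ?D \<and> j < j' \<longrightarrow> ?T (i, j) \<le> ?T (i, j')"
    by (intro allI impI) (elim conjE, rule rows)
  moreover have "\<forall>i i' j. (i, j) \<in> ?D \<and> (i', j) \<in> ?D \<and> i < i' \<longrightarrow> ?T (i, j) < ?T (i', j)"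
    by (intro allI impI) (elim conjE, rule cols)
  ultimately show ?thesis
    unfolding weighted_ssyt_def ssyt_def mem_Collect_eq by (intro conjI ballI) assumption+
qed

lemma card_weighted_ssyt:
  assumes lm: "antimono l" "antimono m" "\<And>i. m i \<le> l i"
    and L: "\<And>i. L \<le> i \<Longrightarrow> l i = 0"
  shows "card (weighted_ssyt n (row_shape l m) a) = card (strip_chains L n l m a)"
proof (rule bij_betw_same_card)
  show "bij_betw (chain_of_tableau l m) (weighted_ssyt n (row_shape l m) a) (strip_chains L n l m a)"
  proof (rule bij_betw_byWitness[where f' = "tableau_of_chain l m"])
    let ?D = "row_shape l m"
    show "chain_of_tableau l m ` weighted_ssyt n ?D a \<subseteq> strip_chains L n l m a"
      by (intro image_subsetI chain_of_tableau_in_strip_chains assms)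
    show "tableau_of_chain l m ` strip_chains L n l m a \<subseteq> weighted_ssyt n ?D a"
      by (intro image_subsetI tableau_of_chain_in_weighted_ssyt[of _ L n l m a] assms)
    show "\<forall>T\<in>weighted_ssyt n ?D a. tableau_of_chain l m (chain_of_tableau l m T) = T"
    proof (intro ballI ext)
      fix T b assume T: "T \<in> weighted_ssyt n ?D a"
      let ?g = "chain_of_tableau l m T"
      have g: "?g \<in> strip_chains L n l m a"
        by (intro chain_of_tableau_in_strip_chains assms T)
      have ss: "T \<in> ssyt ?D" using T by (simp add: weighted_ssyt_def)
      show "tableau_of_chain l m ?g b = T b"
      proof (cases "b \<in> ?D")
        case True
        then obtain i j where b: "b = (Suc i, j)" "m i < j" "j \<le> l i" by (auto simp: row_shape_def)
        have "tableau_of_chain l m ?g b \<le> k \<longleftrightarrow> T b \<le> k" for k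
          using tableau_of_chain_le_iff[OF g b(2,3), of k]
            le_chain_of_tableau_iff[OF ss, of j k i] b by auto
        then show ?thesis by (meson le_antisym order_refl)
      next
        case False
        moreover have "T \<in> extensional ?D" using ss by (auto simp: ssyt_def PiE_def)
        ultimately show ?thesis by (cases b) (simp add: tableau_of_chain_def extensional_def)
      qed
    qed
    show "\<forall>g\<in>strip_chains L n l m a. chain_of_tableau l m (tableau_of_chain l m g) = g"
    proof (intro ballI ext)
      fix g k i assume g: "g \<in> strip_chains L n l m a"
      note b = strip_chains_bounds[OF g, of i k] strip_chains_bounds[OF g, of k i]
      have "{j \<in> {1..l i}. j \<le> m i \<or> tableau_of_chain l m g (Suc i, j) \<le> k} = {1..g k i}"
      proof (intro set_eqI)
        fix j
        show "j \<in> {j \<in> {1..l i}. j \<le> m i \<or> tableau_of_chain l m g (Suc i, j) \<le> k} \<longleftrightarrow>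
          j \<in> {1..g k i}"
          using b tableau_of_chain_le_iff[OF g, of i j k] by (cases "j \<le> m i") auto
      qed
      then show "chain_of_tableau l m (tableau_of_chain l m g) k i = g k i"
        by (simp add: chain_of_tableau_def)
    qed
  qed
qed

section \<open>Coefficients of skew Schur polynomials\<close>

lemma lookup_const_expo [simp]:
  "Poly_Mapping.lookup (const_expo n R) i = (if i \<in> {1..n} then R else 0)"
  by (auto simp: const_expo_def lookup_sum lookup_single when_def sum.delta)

lemma content_eq_iff:
  "content n D T = \<alpha> \<longleftrightarrow> Poly_Mapping.keys \<alpha> \<subseteq> {1..n} \<and>
    (\<forall>k\<in>{1..n}. card {b \<in> D. T b = k} = Poly_Mapping.lookup \<alpha> k)"
proof -
  have content: "Poly_Mapping.lookup (content n D T) k =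
      (if k \<in> {1..n} then card {b \<in> D. T b = k} else 0)" for k
    by (auto simp: content_def lookup_sum lookup_single when_def sum.delta)
  show ?thesis
    unfolding poly_mapping_eq_iff fun_eq_iff content subset_iff in_keys_iff
    by (auto split: if_splits) (metis gr_implies_not0)+
qed

text \<open>\<open>weighted_ssyt\<close> reads the weight on \<open>{1..n}\<close> only, so
  exponents with other variables are excluded separately.\<close>

lemma lookup_skew_schur:
  assumes "finite D"
  shows "Poly_Mapping.lookup (skew_schur n D) \<alpha> =
    (if Poly_Mapping.keys \<alpha> \<subseteq> {1..n}
     then real (card (weighted_ssyt n D (Poly_Mapping.lookup \<alpha>))) else 0)"
proof -
  let ?S = "{T. T \<in> ssyt D \<and> T ` D \<subseteq> {1..n}}"
  have "Poly_Mapping.lookup (skew_schur n D) \<alpha> = (\<Sum>T\<in>?S. if content n D T = \<alpha> then 1 else 0)"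
    by (simp add: skew_schur_def lookup_sum lookup_single when_def)
  also have "\<dots> = real (card {T \<in> ?S. content n D T = \<alpha>})"
    using finite_ssyt_bounded[OF assms, of n] by (simp flip: sum.inter_filter)
  also have "{T \<in> ?S. content n D T = \<alpha>} =
      (if Poly_Mapping.keys \<alpha> \<subseteq> {1..n} then weighted_ssyt n D (Poly_Mapping.lookup \<alpha>) else {})"
    by (auto simp: content_eq_iff weighted_ssyt_def)
  finally show ?thesis by simp
qed

text \<open>Below \<kappa> the map from \<beta> to \<open>\<kappa> - \<beta>\<close> is an
  involution, so nothing is truncated and no two terms merge.\<close>

lemma lookup_poly_reflect:
  assumes "\<And>\<beta>. \<beta> \<in> Poly_Mapping.keys f \<Longrightarrow> expo_le \<beta> \<kappa>"
  shows "Poly_Mapping.lookup (poly_reflect \<kappa> f) \<alpha> =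
    (if expo_le \<alpha> \<kappa> then Poly_Mapping.lookup f (\<kappa> - \<alpha>) else 0)"
proof -
  have reflect_iff: "\<kappa> - \<beta> = \<alpha> \<longleftrightarrow> expo_le \<alpha> \<kappa> \<and> \<beta> = \<kappa> - \<alpha>" if "expo_le \<beta> \<kappa>" for \<beta>
  proof -
    let ?a = "Poly_Mapping.lookup \<alpha>" and ?b = "Poly_Mapping.lookup \<beta>"
      and ?k = "Poly_Mapping.lookup \<kappa>"
    have "?k i - ?b i = ?a i \<longleftrightarrow> ?a i \<le> ?k i \<and> ?b i = ?k i - ?a i" for i
      using that unfolding expo_le_def by (auto dest: spec[of _ i])
    then show ?thesis
      by (simp only: expo_le_def poly_mapping_eq_iff fun_eq_iff lookup_minus minus_apply all_conj_distrib)
  qed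
  have "Poly_Mapping.lookup (poly_reflect \<kappa> f) \<alpha> =
      (\<Sum>\<beta>\<in>Poly_Mapping.keys f. if \<kappa> - \<beta> = \<alpha> then Poly_Mapping.lookup f \<beta> else 0)"
    by (simp add: poly_reflect_def lookup_sum lookup_single when_def)
  also have "\<dots> = (\<Sum>\<beta>\<in>Poly_Mapping.keys f.
      if \<beta> = \<kappa> - \<alpha> then if expo_le \<alpha> \<kappa> then Poly_Mapping.lookup f \<beta> else 0 else 0)"
    by (rule sum.cong) (use assms reflect_iff in auto)
  also have "\<dots> = (if expo_le \<alpha> \<kappa> then Poly_Mapping.lookup f (\<kappa> - \<alpha>) else 0)"
    by (auto simp: sum.delta' sum.delta in_keys_iff)
  finally show ?thesis .
qed

section \<open>Partitions given as lists, translated to row functions\<close>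

lemma skew_shape_eq_row_shape:
  "skew_shape lam mu = row_shape (\<lambda>i. part lam (Suc i)) (\<lambda>i. part mu (Suc i))"
proof (intro set_eqI)
  fix b show "b \<in> skew_shape lam mu \<longleftrightarrow>
      b \<in> row_shape (\<lambda>i. part lam (Suc i)) (\<lambda>i. part mu (Suc i))"
    by (cases b; cases "fst b") (auto simp: skew_shape_def row_shape_def)
qed

lemma antimono_part:
  assumes "is_partition lam"
  shows "antimono (\<lambda>i. part lam (Suc i))"
proof (rule antimonoI)
  fix i j :: nat assume "i \<le> j"
  then show "part lam (Suc j) \<le> part lam (Suc i)"
    using assms by (cases "i = j") (auto simp: is_partition_def Defs.part_def sorted_wrt_iff_nth_less)
qed

lemma part_replicate_append:
  "part (replicate n R @ mu) (Suc i) = complement_rows n R (\<lambda>i. part mu (Suc i)) i"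
  by (auto simp: Defs.part_def complement_rows_def nth_append)

lemma reversal_permutes:
  fixes n :: nat
  shows "(\<lambda>k. if k \<in> {1..n} then n + 1 - k else k) permutes {1..n}"
  by (rule bij_imp_permutes)
    (auto intro!: bij_betw_byWitness[where f' = "\<lambda>k. if k \<in> {1..n} then n + 1 - k else k"])

theorem corollary3p2:
  fixes lam mu :: "nat list" and n R :: nat
  assumes "is_partition lam" and "is_partition mu" and "contained mu lam"
    and "lam \<noteq> []"
    and "n \<ge> 1"
    and "skew_schur n (skew_shape lam mu) \<noteq> 0"
    and "R \<ge> part lam 1"
  shows "contained lam (replicate n R @ mu) \<and>
         skew_schur n (rect_complement n R lam mu) \<noteq> 0 \<and>
         (\<forall>\<alpha> \<in> Poly_Mapping.keys (skew_schur n (rect_complement n R lam mu)).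
            expo_le \<alpha> (const_expo n R)) \<and>
         poly_N (skew_schur n (skew_shape lam mu)) =
           poly_dual (const_expo n R) (skew_schur n (rect_complement n R lam mu))"
proof -
  define l where "l = (\<lambda>i. part lam (Suc i))"
  define m where "m = (\<lambda>i. part mu (Suc i))"
  define e where "e = complement_rows n R m"
  \<comment> \<open>Large enough that \<open>l\<close> and \<open>m\<close> vanish from row
    \<open>L - n\<close> on, and \<open>e\<close>, which has \<open>n\<close> more rows, from row
    \<open>L\<close> on.\<close>
  define L where "L = n + length lam + length mu"
  define \<kappa> where "\<kappa> = const_expo n R"
  define f where "f = skew_schur n (skew_shape lam mu)"
  define f' where "f' = skew_schur n (rect_complement n R lam mu)"
  have anti: "antimono l" "antimono m"
    using antimono_part assms(1,2) by (auto simp: l_def m_def)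
  have ml: "m i \<le> l i" for i using assms(3) by (simp add: contained_def l_def m_def)
  have lR: "l i \<le> R" for i
    using antimonoD[OF anti(1), of 0 i] assms(7) by (simp add: l_def)
  have mR: "m i \<le> R" for i using ml[of i] lR[of i] by simp
  have l_zero: "l i = 0" if "L \<le> i + n" for i using that by (simp add: l_def Defs.part_def L_def)
  have m_zero: "m i = 0" if "L \<le> i + n" for i using that ml[of i] l_zero[of i] by simp
  have e_zero: "e i = 0" if "L \<le> i" for i
    using that m_zero[of "i - n"] by (simp add: e_def complement_rows_def L_def)
  have e_anti: "antimono e"
    using mR antimonoD[OF anti(2)] by (auto simp: antimono_def e_def complement_rows_def diff_le_mono)
  have shape: "skew_shape lam mu = row_shape l m"
    by (simp add: skew_shape_eq_row_shape l_def m_def)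
  have shape': "rect_complement n R lam mu = row_shape e l"
    by (simp add: rect_complement_def skew_shape_eq_row_shape part_replicate_append
        l_def m_def e_def)
  have f_lookup: "Poly_Mapping.lookup f \<alpha> = (if Poly_Mapping.keys \<alpha> \<subseteq> {1..n}
      then real (card (strip_chains L n l m (Poly_Mapping.lookup \<alpha>))) else 0)" for \<alpha>
    using lookup_skew_schur[OF finite_skew_shape, of n lam mu \<alpha>]
      card_weighted_ssyt[of l m L n, OF anti ml l_zero] by (simp add: f_def shape)

  obtain \<alpha> where "Poly_Mapping.lookup f \<alpha> \<noteq> 0"
    using assms(6) by (auto simp: f_def poly_mapping_eq_iff fun_eq_iff)
  then have "strip_chains L n l m (Poly_Mapping.lookup \<alpha>) \<noteq> {}"
    by (auto simp: f_lookup split: if_splits)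
  then obtain g where g: "g \<in> strip_chains L n l m (Poly_Mapping.lookup \<alpha>)" by blast
  \<comment> \<open>Here the nonvanishing of the polynomial enters: a chain of \<open>n\<close>
    steps exists, so columns have at most \<open>n\<close> boxes, which gives the
    containment.\<close>
  have "l (i + n) \<le> m i" for i
    using strip_chains_shift[OF g, of 0 n i] strip_chainsD(1,2)[OF g] by simp
  then have "l i \<le> m (i - n)" if "n \<le> i" for i
    using that by (metis le_add_diff_inverse2)
  then have le: "l i \<le> e i" for i
    using lR[of i] by (cases "i < n") (simp_all add: e_def complement_rows_def)
  then have "contained lam (replicate n R @ mu)"
    unfolding contained_def
  proof (intro allI impI)
    fix i :: nat assume "1 \<le> i"
    then obtain j where "i = Suc j" by (cases i) auto
    then show "part lam i \<le> part (replicate n R @ mu) i"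
      using le[of j] by (simp add: part_replicate_append e_def l_def m_def)
  qed

  have f'_lookup: "Poly_Mapping.lookup f' \<beta> = (if Poly_Mapping.keys \<beta> \<subseteq> {1..n}
      then real (card (strip_chains L n e l (Poly_Mapping.lookup \<beta>))) else 0)" for \<beta>
    using lookup_skew_schur[OF finite_skew_shape, of n "replicate n R @ mu" lam \<beta>]
      card_weighted_ssyt[of e l L n, OF e_anti anti(1) le e_zero]
    by (simp add: f'_def shape' flip: rect_complement_def)
  \<comment> \<open>Kept general in \<open>u\<close> and \<open>v\<close> to serve both the original
    shape and its complement.\<close>
  have bounded: "expo_le \<beta> \<kappa>" if \<beta>: "Poly_Mapping.keys \<beta> \<subseteq> {1..n}"
    "card (strip_chains L n u v (Poly_Mapping.lookup \<beta>)) \<noteq> 0" "u 0 \<le> R" for \<beta> u v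
  proof -
    obtain h where h: "h \<in> strip_chains L n u v (Poly_Mapping.lookup \<beta>)"
      using \<beta>(2) by fastforce
    have "Poly_Mapping.lookup \<beta> k \<le> Poly_Mapping.lookup \<kappa> k" for k
      using strip_chains_weight_le[OF h, of k] \<beta>(1,3)
      by (cases "k \<in> {1..n}") (auto simp: \<kappa>_def in_keys_iff subset_iff)
    then show ?thesis by (simp add: expo_le_def)
  qed
  have f_bounded: "expo_le \<alpha> \<kappa>" if "Poly_Mapping.lookup f \<alpha> \<noteq> 0" for \<alpha>
    using bounded[of \<alpha> l m] that lR[of 0] by (simp add: f_lookup split: if_splits)
  have "e 0 \<le> R" using assms(5) by (simp add: e_def complement_rows_def)
  then have f'_bounded: "expo_le \<beta> \<kappa>" if "\<beta> \<in> Poly_Mapping.keys f'" for \<beta>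
    using bounded[of \<beta> e l] that by (simp add: f'_lookup in_keys_iff split: if_splits)

  have coeff: "Poly_Mapping.lookup f' (\<kappa> - \<alpha>) = Poly_Mapping.lookup f \<alpha>" if le: "expo_le \<alpha> \<kappa>" for \<alpha>
  proof -
    let ?b = "Poly_Mapping.lookup (\<kappa> - \<alpha>)" and ?p = "\<lambda>k. if k \<in> {1..n} then n + 1 - k else k"
    have le_R: "Poly_Mapping.lookup \<alpha> k \<le> (if k \<in> {1..n} then R else 0)" for k
      using le by (simp add: expo_le_def \<kappa>_def)
    have keys: "Poly_Mapping.keys \<alpha> \<subseteq> {1..n}" "Poly_Mapping.keys (\<kappa> - \<alpha>) \<subseteq> {1..n}"
    proof -
      show "Poly_Mapping.keys \<alpha> \<subseteq> {1..n}"
      proof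
        fix k assume "k \<in> Poly_Mapping.keys \<alpha>"
        then show "k \<in> {1..n}" using le_R[of k] by (auto simp: in_keys_iff split: if_splits)
      qed
      show "Poly_Mapping.keys (\<kappa> - \<alpha>) \<subseteq> {1..n}"
        by (auto simp: in_keys_iff lookup_minus \<kappa>_def split: if_splits)
    qed
    \<comment> \<open>For \<open>k < n\<close> the reversal sends \<open>Suc k\<close> to
      \<open>n - k\<close>, so both terms belong to the same variable. Complementation yields the
      reversed weight, and symmetry then removes the reversal.\<close>
    have "Poly_Mapping.lookup \<alpha> (n - k) + (?b \<circ> ?p) (Suc k) = R" if "k < n" for k
      using that le_R[of "n - k"] by (auto simp: lookup_minus \<kappa>_def)
    then have "card (strip_chains L n l m (Poly_Mapping.lookup \<alpha>)) =
        card (strip_chains L n e l (?b \<circ> ?p))"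
      unfolding e_def
      by (intro card_strip_chains_complement lR mR l_zero m_zero) (auto simp: L_def)
    also have "\<dots> = card (strip_chains L n e l ?b)"
      by (intro card_strip_chains_permute reversal_permutes e_zero order_refl)
    finally show ?thesis using keys by (simp add: f_lookup f'_lookup)
  qed
  \<comment> \<open>For exponents not below \<kappa> both coefficients are 0, by
    \<open>f_bounded\<close> on the right. Applying \<open>poly_N\<close> to this equation is the
    claim, and \<open>f' = 0\<close> would force \<open>f = 0\<close>.\<close>
  have reflect: "poly_reflect \<kappa> f' = f"
  proof (rule poly_mapping_eqI)
    fix \<alpha>
    show "Poly_Mapping.lookup (poly_reflect \<kappa> f') \<alpha> = Poly_Mapping.lookup f \<alpha>"
      using lookup_poly_reflect[of f' \<kappa> \<alpha>, OF f'_bounded] f_bounded[of \<alpha>] coeff[of \<alpha>]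
      by (cases "expo_le \<alpha> \<kappa>") auto
  qed
  then have "f' \<noteq> 0" using assms(6) by (auto simp: f_def poly_reflect_def)
  with \<open>contained lam (replicate n R @ mu)\<close> f'_bounded reflect show ?thesis
    by (simp add: poly_dual_def f_def f'_def \<kappa>_def)
qed

end
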